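(* Fix integers $m\ge 2$ and $c\ge 1$. There exist constants $C,s_0>0$ depending only on $m,c$ such that for all integers $s\ge s_0$, with $n=ms+c$ and $\ell=s-c$, every shifted family $\mathcal F\subset 2^{[n]}$ with $\nu(\mathcal F)<s$ satisfies \[ |2^{[n]}\setminus\mathcal F|\ge (2c+3)\binom{n}{m-1}-Cs^{m-2} \] provided one of the following holds: \begin{itemize} \item $c\ge 2$ and $\mathcal F\not\subseteq\mathcal Q(m,s,\ell)$; \item $c=1$, $\mathcal F\not\subseteq\mathcal Q(m,s,\ell)$ and $\mathcal F\not\subseteq\mathcal W(m,s,\ell)$. \end{itemize}
   Context: $[b]=\{1,\dots,b\}$. $\nu(\mathcal F)$ is the maximum number of pairwise disjoint sets in $\mathcal F$. $\mathcal Q(m,s,\ell)=\{P\subset[n]:|P|+|P\cap[ms-c-1]|\ge 2m\}$ and $\mathcal W(m,s,\ell)=\{P\subset[n]:|P\cap[ms-1]|\ge m\}$. Writing a set as $(a_1,\dots,a_k)$ with $a_1<\dots<a_k$, $(a_1,\dots,a_k)$ can be shifted to $(b_1,\dots,b_k)$ if $a_i\ge b_i$ for all $i$; a family is shifted if it is closed under this operation. (The paper writes the error term as $+O(s^{m-2})$ with $m,c$ fixed, $s\to\infty$.) *)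

theory Defs
  imports Complex_Main "HOL-Library.Disjoint_Sets"
begin

text \<open>
  The ground set \<open>[n]\<close> is \<open>{1..n}\<close> and families of subsets of it have type \<open>nat set set\<close>.
  The truncated difference in \<open>{1..b}\<close> is harmless: if the integer value of \<open>b\<close> is
  nonpositive, both readings give the empty set.
  \<open>matching_number\<close> is only meaningful for finite families, where the maximum exists.
\<close>

definition matching_number :: "'a set set \<Rightarrow> nat" where
  "matching_number F = Max {card M | M. M \<subseteq> F \<and> disjoint M}"

definition shifts_to :: "nat set \<Rightarrow> nat set \<Rightarrow> bool" where
  "shifts_to A B \<longleftrightarrow> card A = card B \<and>
     (\<forall>i < card A. sorted_list_of_set A ! i \<ge> sorted_list_of_set B ! i)"

definition shifted :: "nat \<Rightarrow> nat set set \<Rightarrow> bool" where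
  "shifted n F \<longleftrightarrow>
     (\<forall>A \<in> F. \<forall>B. B \<subseteq> {1..n} \<longrightarrow> shifts_to A B \<longrightarrow> B \<in> F)"

text \<open>
  The parameters \<open>m, s, l\<close> with \<open>l \<le> s\<close> determine \<open>c = s - l\<close> and \<open>n = m * s + c\<close>.
\<close>

definition family_Q :: "nat \<Rightarrow> nat \<Rightarrow> nat \<Rightarrow> nat set set" where
  "family_Q m s l = (let c = s - l; n = m * s + c in
     {P. P \<subseteq> {1..n} \<and> card P + card (P \<inter> {1..m * s - c - 1}) \<ge> 2 * m})"

definition family_W :: "nat \<Rightarrow> nat \<Rightarrow> nat \<Rightarrow> nat set set" where
  "family_W m s l = (let c = s - l; n = m * s + c in
     {P. P \<subseteq> {1..n} \<and> card (P \<inter> {1..m * s - 1}) \<ge> m})"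

end

theory Submission
  imports Defs
begin

text \<open>
  Fix a large constant \<open>M\<close> and the top block \<open>{n-M<..n}\<close>, and consider for each \<open>(m-1)\<close>-set \<open>D\<close> below the block its trace: the sets \<open>S\<close> in the block with \<open>D \<union> S \<in> F\<close>. If all but
  \<open>O(s^(m-2))\<close> of the \<open>D\<close> have at least \<open>2c+3\<close> sets missing from their trace, the bound follows by
  counting pairs \<open>(D, S)\<close>. Otherwise some trace \<open>G\<close> with at most \<open>2c+2\<close> missing sets occurs so often that
  one can choose constantly many disjoint \<open>D\<close> with this trace, avoiding any given bounded set. Being
  shifted, \<open>G\<close> then contains \<open>M-c\<close> disjoint sets, or looks like the trace of \<open>\<Q>\<close>, or (for \<open>c = 1\<close>) like
  that of \<open>\<W>\<close>. In the first case, attaching these sets to distinct \<open>D\<close> uses up the block, and the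
  remaining elements split into \<open>m\<close>-sets of \<open>F\<close>, since \<open>F\<close> misses only \<open>O(s^(m-1))\<close> sets; this gives \<open>s\<close>
  disjoint members. In the other two cases a member of \<open>F\<close> outside \<open>\<Q>\<close>, respectively \<open>\<W>\<close>, consumes
  enough of the block for the same construction to supply \<open>s-1\<close> further disjoint members.
\<close>

section \<open>Compression order and packings\<close>

text \<open>Shifting down and enlarging in one relation: the injection need not be onto
  \<open>B\<close>. Injections compose and glue more easily than the sorted lists behind
  \<open>shifts_to\<close>.\<close>

definition compresses :: "nat set \<Rightarrow> nat set \<Rightarrow> bool" where
  "compresses A B \<longleftrightarrow> (\<exists>f. inj_on f A \<and> f ` A \<subseteq> B \<and> (\<forall>a\<in>A. f a \<le> a))"

definition compression_closed :: "nat set \<Rightarrow> nat set set \<Rightarrow> bool" where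
  "compression_closed V F \<longleftrightarrow>
     F \<subseteq> Pow V \<and> (\<forall>A\<in>F. \<forall>B. B \<subseteq> V \<longrightarrow> compresses A B \<longrightarrow> B \<in> F)"

text \<open>The avoided set \<open>X\<close> is kept free for one further member of the family;
  \<open>X = {}\<close> gives an ordinary matching of size \<open>q\<close>.\<close>

definition has_packing :: "'a set set \<Rightarrow> 'a set \<Rightarrow> nat \<Rightarrow> bool" where
  "has_packing F X q \<longleftrightarrow>
     (\<exists>M. M \<subseteq> F \<and> disjoint M \<and> card M = q \<and> (\<forall>A\<in>M. A \<inter> X = {}))"

lemma compresses_mono: "A \<subseteq> B \<Longrightarrow> compresses A B"
  unfolding compresses_def by (rule exI[of _ id]) auto

lemma compresses_trans:
  assumes "compresses A B" "compresses B C"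
  shows "compresses A C"
proof -
  obtain f where f: "inj_on f A" "f ` A \<subseteq> B" "\<forall>a\<in>A. f a \<le> a"
    using assms(1) unfolding compresses_def by blast
  obtain g where g: "inj_on g B" "g ` B \<subseteq> C" "\<forall>b\<in>B. g b \<le> b"
    using assms(2) unfolding compresses_def by blast
  have "inj_on (g \<circ> f) A" using f g by (intro comp_inj_on inj_on_subset[OF g(1)])
  moreover have "(g \<circ> f) ` A \<subseteq> C" using f(2) g(2) by auto
  moreover have "(g \<circ> f) a \<le> a" if "a \<in> A" for a
  proof -
    have "g (f a) \<le> f a" "f a \<le> a" using f g that by auto
    then show ?thesis by simp
  qed
  ultimately show ?thesis unfolding compresses_def by blast
qed

lemma compresses_Un:
  assumes "compresses A B" "compresses A' B'" "B \<inter> B' = {}"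
  shows "compresses (A \<union> A') (B \<union> B')"
proof -
  obtain f where f: "inj_on f A" "f ` A \<subseteq> B" "\<forall>a\<in>A. f a \<le> a"
    using assms(1) unfolding compresses_def by blast
  obtain g where g: "inj_on g A'" "g ` A' \<subseteq> B'" "\<forall>b\<in>A'. g b \<le> b"
    using assms(2) unfolding compresses_def by blast
  define h where "h x = (if x \<in> A then f x else g x)" for x
  have "inj_on h (A \<union> A')"
  proof (rule inj_onI)
    fix x y assume xy: "x \<in> A \<union> A'" "y \<in> A \<union> A'" "h x = h y"
    have "x \<in> A \<longleftrightarrow> y \<in> A" using xy f(2) g(2) assms(3) by (auto simp: h_def split: if_splits)
    then show "x = y" using xy f(1) g(1) by (auto simp: h_def inj_on_def split: if_splits)
  qed
  moreover have "h ` (A \<union> A') \<subseteq> B \<union> B'" using f g by (auto simp: h_def)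
  moreover have "\<forall>a\<in>A \<union> A'. h a \<le> a" using f g by (auto simp: h_def)
  ultimately show ?thesis unfolding compresses_def by blast
qed

lemma compresses_image:
  assumes "inj_on b I" "inj_on a I" "\<And>i. i \<in> I \<Longrightarrow> a i \<le> (b i :: nat)"
  shows "compresses (b ` I) (a ` I)"
  unfolding compresses_def
  by (rule exI[of _ "a \<circ> inv_into I b"])
    (use assms in \<open>auto simp: inj_on_def inv_into_f_f\<close>)

lemma compresses_pair:
  assumes "a \<noteq> a'" "b \<noteq> b'" "b \<le> a" "b' \<le> a'"
  shows "compresses {a, a'} {b, b'}"
  unfolding compresses_def
  by (rule exI[of _ "\<lambda>x. if x = a then b else b'"]) (use assms in \<open>auto simp: inj_on_def\<close>)

text \<open>Each element is sent to \<open>l\<close> plus its rank in \<open>P\<close>; since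
  \<open>P\<close> lies above \<open>l\<close>, this never exceeds the element itself.\<close>

lemma compresses_interval:
  assumes "finite P" "P \<subseteq> {l<..}" "card P \<le> r"
  shows "compresses P {l<..l + r}"
proof -
  define f where "f x = l + card (P \<inter> {..x})" for x
  have mono: "f x < f y" if "x \<in> P" "y \<in> P" "x < y" for x y
  proof -
    have "card (P \<inter> {..x}) < card (P \<inter> {..y})"
    proof (rule psubset_card_mono)
      have "y \<in> P \<inter> {..y} - P \<inter> {..x}" using that by simp
      moreover have "P \<inter> {..x} \<subseteq> P \<inter> {..y}" using that by auto
      ultimately show "P \<inter> {..x} \<subset> P \<inter> {..y}" by blast
    qed (use assms(1) in simp)
    then show ?thesis by (simp add: f_def)
  qed
  have "inj_on f P"
  proof (rule inj_onI)
    fix x y assume "x \<in> P" "y \<in> P" "f x = f y"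
    then show "x = y" using mono[of x y] mono[of y x] by (cases x y rule: linorder_cases) auto
  qed
  moreover have "f ` P \<subseteq> {l<..l + r}"
  proof
    fix z assume "z \<in> f ` P"
    then obtain x where x: "x \<in> P" "z = f x" by blast
    have "card (P \<inter> {..x}) \<le> card P" using assms(1) by (intro card_mono) auto
    moreover have "card (P \<inter> {..x}) > 0" using x assms(1) by (auto simp: card_gt_0_iff)
    ultimately show "z \<in> {l<..l + r}" using x assms(3) by (auto simp: f_def)
  qed
  moreover have "f x \<le> x" if "x \<in> P" for x
  proof -
    have "card (P \<inter> {..x}) \<le> card {l<..x}" using assms(2) by (intro card_mono) auto
    moreover have "l < x" using that assms(2) by auto
    ultimately show ?thesis by (simp add: f_def)
  qed
  ultimately show ?thesis unfolding compresses_def by blast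
qed

lemma shifts_to_image:
  assumes "finite A" "inj_on f A" "\<And>a. a \<in> A \<Longrightarrow> f a \<le> a"
  shows "shifts_to A (f ` A)"
  unfolding shifts_to_def
proof (intro conjI allI impI)
  show c: "card A = card (f ` A)" using assms(2) by (simp add: card_image)
  fix i assume i: "i < card A"
  let ?x = "sorted_list_of_set A" and ?y = "sorted_list_of_set (f ` A)"
  have lx: "length ?x = card A" and ly: "length ?y = card A" using c by simp_all
  have xA: "?x ! k \<in> A" if "k < card A" for k
    using that assms(1) nth_mem[of k ?x] lx by simp
  show "?y ! i \<le> ?x ! i"
  proof (rule ccontr)
    assume "\<not> ?thesis"
    then have less: "?x ! i < ?y ! i" by simp
    have "f ` ((!) ?x ` {..i}) \<subseteq> (!) ?y ` {..<i}"
    proof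
      fix z assume "z \<in> f ` ((!) ?x ` {..i})"
      then obtain k where k: "k \<le> i" "z = f (?x ! k)" by auto
      have xk: "?x ! k \<in> A" using xA i k by simp
      have "?x ! k \<le> ?x ! i" using k i lx by (intro sorted_nth_mono) auto
      then have "z < ?y ! i" using assms(3)[OF xk] less k by simp
      moreover have "z \<in> set ?y" using xk k assms(1) by simp
      then obtain r where r: "r < card A" "z = ?y ! r" using ly by (metis in_set_conv_nth)
      ultimately have "r < i"
        using sorted_nth_mono[of ?y i r] ly by (cases "r < i") auto
      then show "z \<in> (!) ?y ` {..<i}" using r by blast
    qed
    then have "card (f ` ((!) ?x ` {..i})) \<le> card ((!) ?y ` {..<i})" by (intro card_mono) auto
    also have "\<dots> \<le> i" using card_image_le[of "{..<i}" "(!) ?y"] by simp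
    finally have le: "card (f ` ((!) ?x ` {..i})) \<le> i" .
    have "inj_on ((!) ?x) {..i}" using i lx by (intro inj_on_nth) auto
    moreover have "(!) ?x ` {..i} \<subseteq> A" using xA i by auto
    ultimately have "card (f ` ((!) ?x ` {..i})) = Suc i"
      using assms(2) by (simp add: card_image inj_on_subset)
    with le show False by simp
  qed
qed

section \<open>Partition into \<open>m\<close>-sets of the family\<close>

text \<open>
  If some class of residues mod \<open>q\<close> (in the enumeration of \<open>U\<close>) were missing from \<open>F\<close>, then so
  would be every set with one element in each of \<open>m\<close> consecutive blocks to its right.
\<close>

lemma equitable_partition:
  assumes F: "compression_closed {1..n} F"
    and U: "U \<subseteq> {1..n - L}" "card U = m * q" and L: "L \<le> n" and m: "m \<ge> 1"
    and missing: "card (Pow {1..n} - F) < L * q ^ (m - 1)"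
  shows "\<exists>M. M \<subseteq> F \<and> disjoint M \<and> card M = q \<and> \<Union>M \<subseteq> U \<and> {} \<notin> M"
proof -
  have finU: "finite U" using U finite_subset by blast
  define u where "u = sorted_list_of_set U"
  have lu: "length u = m * q" using U by (simp add: u_def)
  have setu: "set u = U" using finU by (simp add: u_def)
  have su: "sorted_wrt (<) u" by (simp add: u_def)
  have step: "k' < m * q \<Longrightarrow> k \<le> k' \<Longrightarrow> u ! k + (k' - k) \<le> u ! k'" for k k'
  proof (induction k')
    case (Suc k')
    show ?case
    proof (cases "k = Suc k'")
      case False
      have "u ! k' < u ! Suc k'" using su Suc.prems lu by (simp add: sorted_wrt_nth_less)
      with Suc False show ?thesis by simp
    qed simp
  qed simp
  have ub: "u ! k + (m * q - 1 - k) \<le> n - L" if "k < m * q" for k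
  proof -
    have "u ! k + (m * q - 1 - k) \<le> u ! (m * q - 1)" using that by (intro step) auto
    moreover have "u ! (m * q - 1) \<in> U"
      using that lu nth_mem[of "m * q - 1" u] unfolding setu by simp
    ultimately show ?thesis using U by fastforce
  qed
  define A where "A i = (\<lambda>r. u ! (i + r * q)) ` {..<m}" for i
  have idx: "i + r * q < m * q" if "i < q" "r < m" for i r
  proof -
    have "i + r * q < Suc r * q" using that by simp
    also have "\<dots> \<le> m * q" using that by (intro mult_le_mono1) simp
    finally show ?thesis .
  qed
  have uinj: "k = k'" if "u ! k = u ! k'" "k < m * q" "k' < m * q" for k k'
    using that lu distinct_sorted_list_of_set[of U] by (simp add: u_def nth_eq_iff_index_eq)
  have injA: "inj_on (\<lambda>r. u ! (i + r * q)) {..<m}" if "i < q" for i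
  proof (rule inj_onI)
    fix r r' assume "r \<in> {..<m}" "r' \<in> {..<m}" "u ! (i + r * q) = u ! (i + r' * q)"
    then have "i + r * q = i + r' * q" using uinj idx[OF that] by (metis lessThan_iff)
    then show "r = r'" using that by simp
  qed
  have AU: "A i \<subseteq> U" if "i < q" for i using idx[OF that] setu lu by (auto simp: A_def)
  have AF: "A i \<in> F" if i: "i < q" for i
  proof (rule ccontr)
    assume out: "A i \<notin> F"
    \<comment> \<open>The blocks are adjacent intervals ending at \<open>n\<close>: the last is the
      top interval of length \<open>L\<close>, the \<open>m - 1\<close> before it have length
      \<open>q\<close>, and \<open>e r\<close> is the point just left of block
      \<open>r\<close>.\<close>
    define e where "e r = n - L - (m - 1 - r) * q" for r
    define blk where "blk r = {e r<..e r + (if r = m - 1 then L else q)}" for r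
    have mq: "m * q \<le> n - L" using U card_mono[of "{1..n-L}" U] by simp
    have e_Suc: "e (Suc r) = e r + q" if "Suc r < m" for r
    proof -
      have *: "m - 1 - r = Suc (m - 1 - Suc r)" using that by simp
      have "(m - 1 - r) * q \<le> m * q" by (intro mult_le_mono1) simp
      then have "q + (m - 1 - Suc r) * q \<le> n - L" using mq unfolding * by simp
      then show ?thesis unfolding e_def * by simp
    qed
    have e_mono: "e r + q \<le> e r'" if "r < r'" "r' < m" for r r'
      using that
    proof (induction r')
      case (Suc r')
      then show ?case using e_Suc[of r'] by (cases "r = r'") auto
    qed simp
    have blk_disj: "r = r'" if "x \<in> blk r" "x \<in> blk r'" "r < m" "r' < m" for x r r'
    proof (rule ccontr)
      assume "r \<noteq> r'"
      then consider "r < r'" | "r' < r" by linarith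
      then show False using that e_mono[of r r'] e_mono[of r' r]
        by cases (auto simp: blk_def split: if_splits)
    qed
    have e_last: "e (m - 1) = n - L" by (simp add: e_def)
    have blk_sub: "blk r \<subseteq> {1..n}" if "r < m" for r
    proof (cases "r = m - 1")
      case True then show ?thesis using e_last L by (auto simp: blk_def)
    next
      case False
      then have "e r + q \<le> e (m - 1)" using that by (intro e_mono) auto
      then show ?thesis using False e_last L by (auto simp: blk_def)
    qed
    \<comment> \<open>At least \<open>(m - 1 - r) * q\<close> elements of \<open>U\<close> lie above
      this one, and none exceeds \<open>n - L\<close>. Writing \<open>m\<close> as
      \<open>r + 1 + d\<close> removes the truncated subtraction.\<close>
    have u_e: "u ! (i + r * q) \<le> e r" if r: "r < m" for r
    proof -
      obtain d where d: "m = r + 1 + d" using r by (metis Suc_eq_plus1 add.commute less_iff_Suc_add add_Suc_right)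
      have "(m - 1 - r) * q \<le> m * q - 1 - (i + r * q)"
        using i unfolding d by (simp add: algebra_simps)
      then have "u ! (i + r * q) + (m - 1 - r) * q \<le> n - L" using ub[OF idx[OF i r]] by linarith
      then show ?thesis by (simp add: e_def)
    qed
    \<comment> \<open>The transversals of the blocks yield \<open>L * q ^ (m - 1)\<close> distinct
      sets that compress to \<open>A i\<close>, hence that many sets missing from
      \<open>F\<close>.\<close>
    define B where "B = PiE {..<m} blk"
    have binj: "inj_on b {..<m}" if "b \<in> B" for b
    proof (rule inj_onI)
      fix r r' assume r: "r \<in> {..<m}" "r' \<in> {..<m}" "b r = b r'"
      then have "b r \<in> blk r" "b r \<in> blk r'"
        using PiE_mem[of b "{..<m}" blk r] PiE_mem[of b "{..<m}" blk r'] that by (simp_all add: B_def)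
      then show "r = r'" using blk_disj r by blast
    qed
    have "(\<lambda>b. b ` {..<m}) ` B \<subseteq> Pow {1..n} - F"
    proof
      fix Z assume "Z \<in> (\<lambda>b. b ` {..<m}) ` B"
      then obtain b where b: "b \<in> B" and Z: "Z = b ` {..<m}" by blast
      have bm: "b r \<in> blk r" if "r < m" for r using b that by (auto simp: B_def)
      have "Z \<subseteq> {1..n}" using bm blk_sub unfolding Z by blast
      moreover have "Z \<notin> F"
      proof
        assume "Z \<in> F"
        moreover have "compresses Z (A i)" unfolding Z A_def
        proof (rule compresses_image[OF binj[OF b] injA[OF i]])
          fix r assume "r \<in> {..<m}"
          then show "u ! (i + r * q) \<le> b r" using u_e[of r] bm[of r] by (auto simp: blk_def)
        qed
        moreover have "A i \<subseteq> {1..n}" using AU[OF i] U by force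
        ultimately show False using F out unfolding compression_closed_def by blast
      qed
      ultimately show "Z \<in> Pow {1..n} - F" by blast
    qed
    then have "card ((\<lambda>b. b ` {..<m}) ` B) \<le> card (Pow {1..n} - F)" by (intro card_mono) auto
    moreover have "inj_on (\<lambda>b. b ` {..<m}) B"
    proof (rule inj_onI)
      fix b b' assume bb: "b \<in> B" "b' \<in> B" and eq: "b ` {..<m} = b' ` {..<m}"
      have "b r = b' r" if r: "r < m" for r
      proof -
        have "b r \<in> b' ` {..<m}" using eq r by blast
        then obtain r' where r': "r' < m" "b r = b' r'" by auto
        have "b r \<in> blk r" using PiE_mem[of b _ blk r] bb r by (simp add: B_def)
        moreover have "b r \<in> blk r'" using PiE_mem[of b' _ blk r'] bb r' by (simp add: B_def)
        ultimately have "r = r'" using blk_disj r r' by blast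
        then show ?thesis using r' by simp
      qed
      then show "b = b'" using bb PiE_ext[of b "{..<m}" blk b'] by (simp add: B_def)
    qed
    moreover have "card B = L * q ^ (m - 1)"
    proof -
      have "card B = (\<Prod>r<m. card (blk r))" unfolding B_def by (simp add: card_PiE)
      also have "{..<m} = insert (m - 1) {..<m - 1}" using m by auto
      also have "(\<Prod>r\<in>\<dots>. card (blk r)) = L * (\<Prod>r<m - 1. card (blk r))"
        by (simp add: blk_def)
      also have "(\<Prod>r<m - 1. card (blk r)) = (\<Prod>r<m - 1. q)"
        by (intro prod.cong) (auto simp: blk_def)
      finally show ?thesis by simp
    qed
    ultimately show False using missing by (simp add: card_image)
  qed
  have disj: "A i \<inter> A k = {}" if "i < q" "k < q" "i \<noteq> k" for i k
  proof (rule ccontr)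
    assume "A i \<inter> A k \<noteq> {}"
    then obtain r r' where rr: "r < m" "r' < m" "u ! (i + r * q) = u ! (k + r' * q)"
      by (auto simp: A_def)
    then have "i + r * q = k + r' * q" using uinj idx that by blast
    then have "(i + r * q) mod q = (k + r' * q) mod q" by simp
    then show False using that by simp
  qed
  have ne: "A i \<noteq> {}" for i using m by (auto simp: A_def lessThan_empty_iff)
  show ?thesis
  proof (intro exI conjI)
    show "A ` {..<q} \<subseteq> F" using AF by auto
    show "disjoint (A ` {..<q})" using disj by (auto simp: pairwise_def disjnt_def)
    have "inj_on A {..<q}" using disj ne by (intro inj_onI) (metis inf.idem lessThan_iff)
    then show "card (A ` {..<q}) = q" by (simp add: card_image)
    show "\<Union> (A ` {..<q}) \<subseteq> U" using AU by auto
    show "{} \<notin> A ` {..<q}" using ne by (metis imageE)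
  qed
qed

section \<open>Disjoint small sets and packings built on them\<close>

text \<open>Union bound over the points \<open>x\<close> of \<open>X\<close>; deleting
  \<open>x\<close> injects the sets through \<open>x\<close> into the
  \<open>(k - 1)\<close>-sets.\<close>

lemma card_subsets_meeting:
  fixes X :: "nat set"
  assumes "finite X" "k \<ge> 1"
  shows "card {D. D \<subseteq> {1..n} \<and> card D = k \<and> D \<inter> X \<noteq> {}} \<le> card X * n ^ (k - 1)"
proof -
  have one: "card {D. D \<subseteq> {1..n} \<and> card D = k \<and> x \<in> D} \<le> n ^ (k - 1)" (is "card ?A \<le> _") for x :: nat
  proof -
    let ?B = "{E. E \<subseteq> {1..n} \<and> card E = k - 1}"
    have "inj_on (\<lambda>D. D - {x}) ?A" by (rule inj_onI) blast
    moreover have "(\<lambda>D. D - {x}) ` ?A \<subseteq> ?B" using finite_subset[of _ "{1..n}"] by auto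
    ultimately have "card ?A \<le> card ?B" by (rule card_inj_on_le) simp
    also have "\<dots> = n choose (k - 1)" by (simp add: n_subsets)
    also have "\<dots> \<le> n ^ (k - 1)" by (cases "k - 1 \<le> n") (simp_all add: binomial_le_pow binomial_eq_0)
    finally show ?thesis .
  qed
  have "{D. D \<subseteq> {1..n} \<and> card D = k \<and> D \<inter> X \<noteq> {}}
      \<subseteq> (\<Union>x\<in>X. {D. D \<subseteq> {1..n} \<and> card D = k \<and> x \<in> D})" by blast
  then have "card {D. D \<subseteq> {1..n} \<and> card D = k \<and> D \<inter> X \<noteq> {}}
      \<le> card (\<Union>x\<in>X. {D. D \<subseteq> {1..n} \<and> card D = k \<and> x \<in> D})"
    using assms by (intro card_mono) auto
  also have "\<dots> \<le> (\<Sum>x\<in>X. card {D. D \<subseteq> {1..n} \<and> card D = k \<and> x \<in> D})"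
    using assms by (intro card_UN_le)
  also have "\<dots> \<le> (\<Sum>x\<in>X. n ^ (k - 1))" by (intro sum_mono one)
  finally show ?thesis by simp
qed

text \<open>Greedy choice: \<open>X\<close> and the sets chosen so far have boundedly many elements,
  so by \<open>card_subsets_meeting\<close> they cannot meet every member of
  \<open>\<D>\<close>.\<close>

lemma disjoint_members:
  fixes X :: "nat set"
  assumes sub: "\<D> \<subseteq> {D. D \<subseteq> {1..n} \<and> card D = k}" and k: "k \<ge> 1" and X: "finite X"
    and many: "(card X + N * k) * n ^ (k - 1) < card \<D>"
  shows "\<exists>D. (\<forall>i<N. D i \<in> \<D> \<and> D i \<inter> X = {}) \<and> disjoint_family_on D {..<N}"
  using many
proof (induction N)
  case 0
  then show ?case by (simp add: disjoint_family_on_def)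
next
  case (Suc N)
  have "(card X + N * k) * n ^ (k - 1) \<le> (card X + Suc N * k) * n ^ (k - 1)"
    by (intro mult_le_mono1) simp
  then have "(card X + N * k) * n ^ (k - 1) < card \<D>" using Suc.prems by linarith
  from Suc.IH[OF this] obtain D where D: "\<And>i. i < N \<Longrightarrow> D i \<in> \<D>" "\<And>i. i < N \<Longrightarrow> D i \<inter> X = {}"
      "disjoint_family_on D {..<N}" by blast
  define Y where "Y = X \<union> (\<Union>i<N. D i)"
  have finD: "finite (D i)" "card (D i) = k" if "i < N" for i
    using D(1)[OF that] sub finite_subset[of _ "{1..n}"] by auto
  have "finite Y" using X finD by (auto simp: Y_def)
  have "card (\<Union>i<N. D i) \<le> (\<Sum>i<N. card (D i))" by (intro card_UN_le) auto
  also have "\<dots> = N * k" using finD by simp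
  finally have "card Y \<le> card X + N * k" unfolding Y_def using card_Un_le[of X "\<Union>i<N. D i"] by linarith
  then have "card Y * n ^ (k - 1) \<le> (card X + Suc N * k) * n ^ (k - 1)" by (intro mult_le_mono1) simp
  then have "card {E. E \<subseteq> {1..n} \<and> card E = k \<and> E \<inter> Y \<noteq> {}} < card \<D>"
    using card_subsets_meeting[OF \<open>finite Y\<close> k, of n] Suc.prems by linarith
  moreover have "finite {E. E \<subseteq> {1..n} \<and> card E = k \<and> E \<inter> Y \<noteq> {}}" by simp
  ultimately have "\<not> \<D> \<subseteq> {E. E \<subseteq> {1..n} \<and> card E = k \<and> E \<inter> Y \<noteq> {}}"
    using card_mono leD by blast
  then obtain E where E: "E \<in> \<D>" "E \<inter> Y = {}" using sub by blast
  have "\<forall>i<Suc N. (D(N := E)) i \<in> \<D> \<and> (D(N := E)) i \<inter> X = {}"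
    using D E by (auto simp: Y_def less_Suc_eq)
  moreover have "disjoint_family_on (D(N := E)) {..<Suc N}"
  proof -
    have "E \<inter> (\<Union>i<N. D i) = {}" using E(2) unfolding Y_def by blast
    moreover have "disjoint_family_on (D(N := E)) {..<N}"
      using D(3) by (simp add: disjoint_family_on_def)
    ultimately show ?thesis by (simp add: lessThan_Suc disjoint_family_on_insert)
  qed
  ultimately show ?case by blast
qed

text \<open>The sets \<open>D i \<union> S i\<close> are the first \<open>N\<close> members. By
  \<open>room\<close>, at least \<open>m * q\<close> elements below the block avoid \<open>X\<close>
  and all \<open>D i\<close>; \<open>equitable_partition\<close> with \<open>L = M\<close> turns
  them into \<open>q\<close> more.\<close>

lemma has_packing_extend:
  assumes F: "compression_closed {1..n} F" and M: "M \<le> n" and m: "m \<ge> 2"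
    and missing: "card (Pow {1..n} - F) < M * q ^ (m - 1)"
    and D: "\<And>i. i < N \<Longrightarrow> D i \<subseteq> {1..n - M}" "\<And>i. i < N \<Longrightarrow> card (D i) = m - 1"
      "\<And>i. i < N \<Longrightarrow> D i \<inter> X = {}" "disjoint_family_on D {..<N}"
    and S: "\<And>i. i < N \<Longrightarrow> S i \<subseteq> {n - M<..n}" "\<And>i. i < N \<Longrightarrow> S i \<inter> X = {}"
      "disjoint_family_on S {..<N}"
    and DS: "\<And>i. i < N \<Longrightarrow> D i \<union> S i \<in> F"
    and room: "card (X \<inter> {1..n - M}) + (m - 1) * N + m * q \<le> n - M"
  shows "has_packing F X (N + q)"
proof -
  let ?T = "(X \<inter> {1..n - M}) \<union> (\<Union>i<N. D i)"
  have finD: "finite (D i)" "D i \<noteq> {}" if "i < N" for i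
    using D(1,2)[OF that] m finite_subset[of "D i" "{1..n - M}"] by auto
  have "card (\<Union>i<N. D i) \<le> (\<Sum>i<N. card (D i))" by (intro card_UN_le) auto
  also have "\<dots> = (m - 1) * N" using D(2) by simp
  finally have "card ?T \<le> card (X \<inter> {1..n - M}) + (m - 1) * N"
    using card_Un_le[of "X \<inter> {1..n - M}" "\<Union>i<N. D i"] by linarith
  moreover have "card {1..n - M} - card ?T \<le> card ({1..n - M} - ?T)"
    using finD by (intro diff_card_le_card_Diff) auto
  ultimately have "m * q \<le> card ({1..n - M} - ?T)" using room unfolding card_atLeastAtMost by linarith
  then obtain U where U: "U \<subseteq> {1..n - M} - ?T" "card U = m * q"
    by (metis obtain_subset_with_card_n)
  obtain R where R: "R \<subseteq> F" "disjoint R" "card R = q" "\<Union>R \<subseteq> U" "{} \<notin> R"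
    using equitable_partition[OF F _ U(2) M _ missing] U(1) m by auto
  have split: "{1..n - M} \<inter> {n - M<..n} = {}" by auto
  define E where "E i = D i \<union> S i" for i
  have E_disj: "E i \<inter> E k = {}" if "i < N" "k < N" "i \<noteq> k" for i k
  proof -
    have "D i \<inter> D k = {}" "S i \<inter> S k = {}"
      using D(4) S(3) that unfolding disjoint_family_on_def by auto
    moreover have "D a \<inter> S b = {}" if "a < N" "b < N" for a b
    proof -
      have "D a \<inter> S b \<subseteq> {1..n - M} \<inter> {n - M<..n}" using D(1) S(1) that by blast
      then show ?thesis unfolding split by blast
    qed
    then have "D i \<inter> S k = {}" "S i \<inter> D k = {}" using that by blast+
    ultimately show ?thesis unfolding E_def by blast
  qed
  have ER: "E i \<inter> A = {}" if "i < N" "A \<in> R" for i A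
  proof -
    have "A \<subseteq> U" using R that by blast
    then have "A \<inter> D i = {}" "A \<subseteq> {1..n - M}" using U(1) that by auto
    moreover have "S i \<inter> A \<subseteq> {1..n - M} \<inter> {n - M<..n}" using calculation S(1)[OF that(1)] by blast
    then have "S i \<inter> A = {}" unfolding split by blast
    ultimately show ?thesis unfolding E_def by blast
  qed
  have ne: "E i \<noteq> {}" if "i < N" for i using finD that by (auto simp: E_def)
  have injE: "inj_on E {..<N}" 
  proof (rule inj_onI)
    fix i k assume ik: "i \<in> {..<N}" "k \<in> {..<N}" "E i = E k"
    show "i = k" using E_disj[of i k] ne[of k] ik by (cases "i = k") auto
  qed
  have "R \<subseteq> Pow {1..n}" using R(1) F by (auto simp: compression_closed_def)
  then have "finite R" by (rule finite_subset) simp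
  moreover have "E ` {..<N} \<inter> R = {}" 
  proof (rule ccontr)
    assume "E ` {..<N} \<inter> R \<noteq> {}"
    then obtain i where "i < N" "E i \<in> R" by auto
    then show False using ER[of i "E i"] ne by simp
  qed
  ultimately have "card (E ` {..<N} \<union> R) = N + q"
    using R(3) injE by (simp add: card_Un_disjoint card_image)
  moreover have "disjoint (E ` {..<N} \<union> R)"
  proof (rule pairwiseI)
    fix A B assume "A \<in> E ` {..<N} \<union> R" "B \<in> E ` {..<N} \<union> R" "A \<noteq> B"
    then consider i k where "i < N" "k < N" "A = E i" "B = E k" "i \<noteq> k"
      | i where "i < N" "A = E i" "B \<in> R" | i where "i < N" "B = E i" "A \<in> R"
      | "A \<in> R" "B \<in> R" by auto
    then have "A \<inter> B = {}"
    proof cases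
      case 4
      then show ?thesis using R(2) \<open>A \<noteq> B\<close> by (auto simp: pairwise_def disjnt_def)
    qed (use E_disj ER in \<open>blast+\<close>)
    then show "disjnt A B" by (simp add: disjnt_def)
  qed
  moreover have "E ` {..<N} \<union> R \<subseteq> F" using R(1) DS by (auto simp: E_def)
  moreover have "A \<inter> X = {}" if "A \<in> E ` {..<N} \<union> R" for A
    using that
  proof
    assume "A \<in> R"
    then have "A \<subseteq> {1..n - M} - ?T" using R(4) U(1) by blast
    then show ?thesis by blast
  qed (use D(3) S(2) in \<open>auto simp: E_def\<close>)
  ultimately show ?thesis unfolding has_packing_def by blast
qed

section \<open>Structure of a trace with few missing sets\<close>

text \<open>
  Let \<open>n-g\<close> be the largest element whose singleton lies in \<open>G\<close>. If \<open>g = c+1+j\<close> with \<open>0 \<le> j < c\<close>, then \<open>j+1\<close>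
  disjoint sets are needed in the top \<open>g\<close> elements: \<open>j\<close> nested pairs and the remaining middle part.
\<close>

lemma trace_alternatives:
  assumes G: "compression_closed {n - M<..n} G"
    and missing: "card (Pow {n - M<..n} - G) \<le> 2 * c + 2"
    and M: "2 * c + 2 \<le> M" "M \<le> n" and c: "c \<ge> 1"
  obtains
    (packing) S where "\<And>i. i < M - c \<Longrightarrow> S i \<in> G" "disjoint_family_on S {..<M - c}"
  | (Q) "\<And>x. x \<in> {n - M<..n - 2 * c - 1} \<Longrightarrow> {x} \<in> G"
      "\<And>S. S \<subseteq> {n - M<..n} \<Longrightarrow> card S = 2 \<Longrightarrow> S \<in> G"
  | (W) "c = 1" "\<And>x. x \<in> {n - M<..n - 2} \<Longrightarrow> {x} \<in> G"
proof -
  let ?T = "{n - M<..n}"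
  have up: "B \<in> G" if "A \<in> G" "B \<subseteq> ?T" "compresses A B" for A B
    using G that unfolding compression_closed_def by blast
  have bound: "card K \<le> 2 * c + 2" if "K \<subseteq> Pow ?T - G" for K
    using card_mono[OF _ that] missing by simp
  have single_up: "{y} \<in> G" if "{x} \<in> G" "y \<in> {n - M<..x}" "x \<le> n" for x y
    by (rule up[OF that(1)]) (use that in \<open>auto simp: compresses_def\<close>)
  show thesis
  proof (cases "{n - c} \<in> G")
    case True
    show thesis
    proof (rule packing[of "\<lambda>i. {n - c - i}"])
      show "{n - c - i} \<in> G" if "i < M - c" for i
        by (rule single_up[OF True]) (use that M c in auto)
      show "disjoint_family_on (\<lambda>i. {n - c - i}) {..<M - c}"
        using M by (auto simp: disjoint_family_on_def)
    qed
  next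
    case nc: False
    have empty: "{} \<notin> G"
    proof
      assume "{} \<in> G"
      then have "{n - c} \<in> G" by (rule up) (use M c in \<open>auto simp: compresses_mono\<close>)
      with nc show False by simp
    qed
    \<comment> \<open>The empty set and the top \<open>t\<close> singletons: a stock of
      \<open>t + 1\<close> missing sets, to be played off against the bound
      \<open>2 * c + 2\<close>.\<close>
    define K where "K t = insert {} ((\<lambda>i. {n - i}) ` {..<t})" for t
    have card_K: "card (K t) = Suc t" if "t \<le> M" for t
    proof -
      have "inj_on (\<lambda>i. {n - i}) {..<t}" using that M by (auto simp: inj_on_def)
      then show ?thesis unfolding K_def by (subst card_insert_disjoint) (auto simp: card_image)
    qed
    have K_miss: "K t \<subseteq> Pow ?T - G" if "t \<le> M" "\<And>i. i < t \<Longrightarrow> {n - i} \<notin> G" for t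
      using that M empty by (auto simp: K_def)
    define g where "g = (LEAST g. {n - g} \<in> G)"
    \<comment> \<open>Otherwise the top \<open>2 * c + 2\<close> singletons and the empty set would
      be \<open>2 * c + 3\<close> missing sets.\<close>
    have last: "{n - (2 * c + 1)} \<in> G"
    proof (rule ccontr)
      assume out: "{n - (2 * c + 1)} \<notin> G"
      have "{n - i} \<notin> G" if "i < 2 * c + 2" for i
      proof
        assume "{n - i} \<in> G"
        then have "{n - (2 * c + 1)} \<in> G" by (rule single_up) (use that M in auto)
        with out show False by simp
      qed
      then have "card (K (2 * c + 2)) \<le> 2 * c + 2" using M by (intro bound K_miss) auto
      with card_K M show False by simp
    qed
    have g_in: "{n - g} \<in> G" unfolding g_def using last by (rule LeastI)
    have g_le: "g \<le> 2 * c + 1" unfolding g_def using last by (rule Least_le)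
    have g_out: "{n - i} \<notin> G" if "i < g" for i using that not_less_Least unfolding g_def by blast
    have "c < g"
    proof (rule ccontr)
      assume "\<not> c < g"
      then have "{n - c} \<in> G" using M c by (intro single_up[OF g_in]) auto
      with nc show False by simp
    qed
    have gM: "g \<le> M" using g_le M by simp
    note Kg = K_miss[OF gM g_out] card_K[OF gM]
    have finK: "finite (K g)" by (simp add: K_def)
    show thesis
    \<comment> \<open>In this case \<open>K g\<close> already exhausts the allowance of missing
      sets, so every pair lies in \<open>G\<close>.\<close>
    proof (cases "g = 2 * c + 1")
      case True
      show thesis
      proof (rule Q)
        show "{x} \<in> G" if "x \<in> {n - M<..n - 2 * c - 1}" for x
          using single_up[OF last, of x] that by auto
        show "S \<in> G" if S: "S \<subseteq> ?T" "card S = 2" for S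
        proof (rule ccontr)
          assume "S \<notin> G"
          then have "card (insert S (K g)) \<le> 2 * c + 2" using S Kg(1) by (intro bound) auto
          moreover have "S \<notin> K g" using S by (auto simp: K_def)
          ultimately show False using Kg(2) finK True by simp
        qed
      qed
    next
      case False
      define j where "j = g - c - 1"
      have j: "g = c + 1 + j" "j < c" using False g_le \<open>c < g\<close> by (auto simp: j_def)
      \<comment> \<open>A missing pair would force all \<open>g - 1 - i\<close> pairs in
        \<open>?P\<close> to be missing. Together with \<open>K g\<close> this makes
        \<open>2 * g - i = 2 * c + 2 + 2 * j - i\<close>, too many since
        \<open>i < j\<close>.\<close>
      have pairs: "{n - g + 1 + i, n - i} \<in> G" if i: "i < j" for i
      proof (rule ccontr)
        assume out: "{n - g + 1 + i, n - i} \<notin> G"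
        let ?P = "(\<lambda>x. {x, n}) ` {n - g + 1 + i..<n}"
        have "{x, n} \<notin> G" if "x \<in> {n - g + 1 + i..<n}" for x
        proof
          assume "{x, n} \<in> G"
          moreover have "compresses {x, n} {n - g + 1 + i, n - i}"
            using that i j M by (intro compresses_pair) auto
          moreover have "{n - g + 1 + i, n - i} \<subseteq> ?T" using i j M by auto
          ultimately show False using out up by blast
        qed
        then have "K g \<union> ?P \<subseteq> Pow ?T - G" using Kg(1) j M by auto
        then have "card (K g \<union> ?P) \<le> 2 * c + 2" by (rule bound)
        moreover have "K g \<inter> ?P = {}" by (auto simp: K_def doubleton_eq_iff)
        moreover have "card ?P = g - 1 - i"
        proof -
          have "inj_on (\<lambda>x. {x, n}) {n - g + 1 + i..<n}" by (auto simp: inj_on_def doubleton_eq_iff)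
          then show ?thesis using i j M by (simp add: card_image)
        qed
        ultimately show False using i j Kg(2) finK by (simp add: card_Un_disjoint)
      qed
      \<comment> \<open>What remains of the top \<open>g\<close> elements after removing the
        \<open>j\<close> nested pairs.\<close>
      define Z where "Z = {n - g + 1 + j..n - j}"
      have cardZ: "card Z = c + 1 - j" using j M by (simp add: Z_def)
      have ZT: "Z \<subseteq> ?T" using j M by (auto simp: Z_def)
      show thesis
      proof (cases "Z \<in> G")
        case True
        \<comment> \<open>The singletons start at \<open>n - g\<close> and run down exactly to the
          bottom element \<open>n - M + 1\<close> of the block.\<close>
        define S where
          "S i = (if i < j then {n - g + 1 + i, n - i} else if i = j then Z else {n - g - (i - j - 1)})" for i
        show thesis
        proof (rule packing[of S])
          show "S i \<in> G" if "i < M - c" for i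
          proof -
            have "{n - g - (i - j - 1)} \<in> G" if "j < i"
              by (rule single_up[OF g_in]) (use that \<open>i < M - c\<close> j M in auto)
            then show ?thesis using pairs True by (auto simp: S_def)
          qed
          have "S i \<inter> S k = {}" if "i < k" "k < M - c" for i k
            using that j M by (auto simp: S_def Z_def)
          then show "disjoint_family_on S {..<M - c}"
            unfolding disjoint_family_on_def by (metis Int_commute lessThan_iff linorder_neqE_nat)
        qed
      next
        case Zout: False
        \<comment> \<open>\<open>G\<close> is closed upwards, so with \<open>Z\<close> all its
          subsets are missing. For \<open>j = 0\<close> these are \<open>2 ^ (c + 1)\<close> sets,
          which leaves only \<open>c = 1\<close>.\<close>
        have PowZ: "Pow Z \<subseteq> Pow ?T - G"
          using up[of _ Z] Zout ZT compresses_mono by blast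
        have cardPow: "card (Pow Z) = 2 ^ (c + 1 - j)" using cardZ by (simp add: card_Pow Z_def)
        show thesis
        proof (cases "j = 0")
          case True
          have "(2::nat) ^ (c + 1) \<le> 2 * c + 2" using bound[OF PowZ] cardPow True by simp
          moreover have "2 * d + 2 < (2::nat) ^ (d + 1)" if "2 \<le> d" for d
            using that by (induction d rule: dec_induct) auto
          ultimately have "\<not> 2 \<le> c" using leD by blast
          then have "c = 1" using c by simp
          show thesis
          proof (rule W)
            show "{x} \<in> G" if "x \<in> {n - M<..n - 2}" for x
              by (rule single_up[OF g_in]) (use that j True \<open>c = 1\<close> in auto)
          qed fact
        next
          case False
          \<comment> \<open>The \<open>2 * j\<close> singletons of the top \<open>g\<close> elements
            outside \<open>Z\<close>. With \<open>Pow Z\<close> and \<open>{n - 1, n}\<close> they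
            give at least \<open>2 * (c + 1 - j) + 2 * j + 1 = 2 * c + 3\<close> missing
            sets.\<close>
          let ?S = "(\<lambda>i. {n - i}) ` ({..<j} \<union> {g - j..<g})"
          \<comment> \<open>The pair compresses to the two largest elements of \<open>Z\<close>, and
            from there to \<open>Z\<close>. As \<open>j > 0\<close>, it is not counted in
            \<open>Pow Z\<close>.\<close>
          have top: "{n - 1, n} \<notin> G"
          proof
            assume "{n - 1, n} \<in> G"
            moreover have "compresses {n - 1, n} {n - j - 1, n - j}"
              using j M by (intro compresses_pair) auto
            moreover have "compresses {n - j - 1, n - j} Z"
              using j M by (intro compresses_mono) (auto simp: Z_def)
            ultimately show False using Zout ZT up compresses_trans by blast
          qed
          have "?S \<subseteq> K g" unfolding K_def using j by auto
          then have S_miss: "?S \<subseteq> Pow ?T - G" using Kg(1) by (rule order_trans)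
          have "insert {n - 1, n} (Pow Z \<union> ?S) \<subseteq> Pow ?T - G"
            using S_miss PowZ top M by auto
          then have "card (insert {n - 1, n} (Pow Z \<union> ?S)) \<le> 2 * c + 2" by (rule bound)
          moreover have "{n - 1, n} \<notin> Pow Z \<union> ?S" using j False M by (auto simp: Z_def)
          moreover have "Pow Z \<inter> ?S = {}" using j M by (auto simp: Z_def)
          moreover have "card ?S = 2 * j"
          proof -
            have "inj_on (\<lambda>i. {n - i}) ({..<j} \<union> {g - j..<g})" using j M by (auto simp: inj_on_def)
            moreover have "card ({..<j} \<union> {g - j..<g}) = j + j"
              using j by (subst card_Un_disjoint) auto
            ultimately show ?thesis by (simp add: card_image)
          qed
          moreover have "finite (Pow Z)" by (simp add: Z_def)
          ultimately have "Suc (2 ^ (c + 1 - j) + 2 * j) \<le> 2 * c + 2"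
            using cardPow by (simp add: card_Un_disjoint)
          moreover have "2 * d \<le> (2::nat) ^ d" if "1 \<le> d" for d
            using that by (induction d rule: dec_induct) auto
          then have "2 * (c + 1 - j) \<le> (2::nat) ^ (c + 1 - j)" using j by simp
          ultimately show thesis using j by linarith
        qed
      qed
    qed
  qed
qed

section \<open>Packings from a frequent trace\<close>

text \<open>
  The two avoided sets are the leftmost sets outside \<open>\<Q>\<close> (with \<open>2k+1\<close> elements among the last
  \<open>2c+1\<close>) and outside \<open>\<W>\<close>.
\<close>

lemma frequent_trace_has_packing:
  assumes F: "compression_closed {1..n} F" and n: "n = m * s + c"
    and m: "m \<ge> 2" and c: "c \<ge> 1" and M: "2 * c + 2 \<le> M" and s: "2 * M + 2 \<le> s"
    and missing: "2 ^ (m - 1) * card (Pow {1..n} - F) < M * s ^ (m - 1)"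
    and G: "G \<subseteq> Pow {n - M<..n}" "card (Pow {n - M<..n} - G) \<le> 2 * c + 2"
    and many: "(m + c + 1 + M * m) * n ^ (m - 2) <
      card {D. D \<subseteq> {1..n - M} \<and> card D = m - 1 \<and> {S. S \<subseteq> {n - M<..n} \<and> D \<union> S \<in> F} = G}"
    and k: "k \<le> c" "k < m"
  shows "has_packing F {} s
    \<or> has_packing F ({0<..m - 1 - k} \<union> {n - 2 * c - 1<..n - 2 * c + 2 * k}) (s - 1)
    \<or> c = 1 \<and> has_packing F ({0<..m - 1} \<union> {n - 2<..n}) (s - 1)"
proof -
  let ?T = "{n - M<..n}"
  define \<D> where "\<D> = {D. D \<subseteq> {1..n - M} \<and> card D = m - 1 \<and> {S. S \<subseteq> ?T \<and> D \<union> S \<in> F} = G}"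
  have sn: "2 * s + c \<le> n" using n m by simp
  have Mn: "M \<le> n" using s sn by simp
  \<comment> \<open>Every \<open>q\<close> used below is at least half of \<open>s\<close>; the
    factor \<open>2 ^ (m - 1)\<close> in \<open>missing\<close> pays for replacing \<open>s\<close>
    by \<open>q\<close>.\<close>
  have small: "card (Pow {1..n} - F) < M * q ^ (m - 1)" if "s \<le> 2 * q" for q
  proof -
    have "M * s ^ (m - 1) \<le> M * (2 * q) ^ (m - 1)" using that by (intro mult_le_mono2 power_mono) auto
    also have "\<dots> = 2 ^ (m - 1) * (M * q ^ (m - 1))" by (simp add: power_mult_distrib)
    finally have "2 ^ (m - 1) * card (Pow {1..n} - F) < 2 ^ (m - 1) * (M * q ^ (m - 1))"
      using missing by (rule less_le_trans[rotated])
    then show ?thesis by simp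
  qed
  have DG: "S \<subseteq> ?T \<and> D \<union> S \<in> F \<longleftrightarrow> S \<in> G" if "D \<in> \<D>" for D S
    using that unfolding \<D>_def by blast
  have split: "{1..n - M} \<inter> ?T = {}" by auto
  have choose: "\<exists>D. (\<forall>i<N. D i \<in> \<D> \<and> D i \<inter> X = {}) \<and> disjoint_family_on D {..<N}"
    if "finite X" "card X \<le> m + c + 1" "N \<le> M" for N X
  proof (rule disjoint_members[where k = "m - 1" and n = n])
    show "\<D> \<subseteq> {D. D \<subseteq> {1..n} \<and> card D = m - 1}" by (force simp: \<D>_def)
    have "N * (m - 1) \<le> M * m" using that by (intro mult_le_mono) auto
    then have "(card X + N * (m - 1)) * n ^ (m - 2) \<le> (m + c + 1 + M * m) * n ^ (m - 2)"
      using that by (intro mult_le_mono1) simp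
    then show "(card X + N * (m - 1)) * n ^ (m - 1 - 1) < card \<D>"
      using many unfolding \<D>_def by (simp add: numeral_2_eq_2)
  qed (use m that in auto)
  have "\<D> \<noteq> {}" using many unfolding \<D>_def by (metis card.empty not_less_zero)
  then obtain D\<^sub>0 where D\<^sub>0: "D\<^sub>0 \<in> \<D>" by blast
  \<comment> \<open>One set with trace \<open>G\<close> suffices: a compression inside the block
    extends by the identity on \<open>D\<^sub>0\<close>.\<close>
  have clG: "compression_closed ?T G"
    unfolding compression_closed_def
  proof (intro conjI ballI allI impI)
    fix S S' assume S: "S \<in> G" "S' \<subseteq> ?T" "compresses S S'"
    have D0sub: "D\<^sub>0 \<subseteq> {1..n - M}" using D\<^sub>0 by (simp add: \<D>_def)
    have "compresses (D\<^sub>0 \<union> S) (D\<^sub>0 \<union> S')"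
    proof (rule compresses_Un)
      have "D\<^sub>0 \<inter> S' \<subseteq> {1..n - M} \<inter> ?T" using D0sub S(2) by blast
      then show "D\<^sub>0 \<inter> S' = {}" unfolding split by blast
    qed (use S compresses_mono in auto)
    moreover have "D\<^sub>0 \<union> S \<in> F" using DG[OF D\<^sub>0] S(1) by blast
    moreover have "D\<^sub>0 \<union> S' \<subseteq> {1..n}"
    proof -
      have "{1..n - M} \<subseteq> {1..n}" "?T \<subseteq> {1..n}" by auto
      then show ?thesis using D0sub S(2) by blast
    qed
    ultimately have "D\<^sub>0 \<union> S' \<in> F" using F unfolding compression_closed_def by blast
    then show "S' \<in> G" using DG[OF D\<^sub>0] S(2) by blast
  qed (use G in blast)
  have extend: "has_packing F X (N + q)"
    if X: "finite X" "card X \<le> m + c + 1" "N \<le> M" and q: "s \<le> 2 * q"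
      and S: "\<And>i. i < N \<Longrightarrow> S i \<in> G" "\<And>i. i < N \<Longrightarrow> S i \<inter> X = {}" "disjoint_family_on S {..<N}"
      and room: "card (X \<inter> {1..n - M}) + (m - 1) * N + m * q \<le> n - M" for X N q S
  proof -
    obtain D where D: "\<And>i. i < N \<Longrightarrow> D i \<in> \<D>" "\<And>i. i < N \<Longrightarrow> D i \<inter> X = {}" "disjoint_family_on D {..<N}"
      using choose[OF X] by blast
    show ?thesis
    proof (rule has_packing_extend[OF F Mn m small[OF q] _ _ D(2,3) _ S(2,3) _ room])
      show "D i \<subseteq> {1..n - M}" "card (D i) = m - 1" if "i < N" for i
        using D(1)[OF that] by (simp_all add: \<D>_def)
      show "S i \<subseteq> ?T" "D i \<union> S i \<in> F" if "i < N" for i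
        using DG[OF D(1)[OF that]] S(1)[OF that] by blast+
    qed
  qed
  have big: "m + M + 2 \<le> n"
  proof -
    have "m * (2 * M + 2) \<le> m * s" using s by (intro mult_le_mono2)
    moreover have "m * (2 * M + 2) = m * 2 + m * (2 * M)" by (simp add: algebra_simps)
    moreover have "2 * (2 * M) \<le> m * (2 * M)" using m by (intro mult_le_mono1)
    ultimately show ?thesis using n m c by linarith
  qed
  have pred_mult: "(m - 1) * N + N = m * N" for N using m by (cases m) auto
  from clG G(2) M Mn c show ?thesis
  proof (cases rule: trace_alternatives)
    case (packing S)
    \<comment> \<open>The fit is exact:
      \<open>(m - 1) * N + m * q = m * s - N = n - M\<close>.\<close>
    define N where "N = M - c"
    define q where "q = s - N"
    have "has_packing F {} (N + q)"
    proof (rule extend)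
      have "m * s = m * N + m * q" using s by (simp add: N_def q_def flip: distrib_left)
      moreover have "N + c = M" using M by (simp add: N_def)
      ultimately show "card ({} \<inter> {1..n - M}) + (m - 1) * N + m * q \<le> n - M"
        using pred_mult[of N] n by simp
    qed (use packing s N_def q_def in auto)
    moreover have "N + q = s" using s by (simp add: N_def q_def)
    ultimately show ?thesis by simp
  next
    case Q
    define X where "X = {0<..m - 1 - k} \<union> {n - 2 * c - 1<..n - 2 * c + 2 * k}"
    \<comment> \<open>\<open>X\<close> takes the lowest \<open>2 * k + 1\<close> of the last
      \<open>2 * c + 1\<close> elements. The other \<open>2 * (c - k)\<close> form
      \<open>c - k\<close> pairs, and the rest of the block is used as singletons. Since
      \<open>N = M - c - k - 1\<close>, the room below is filled exactly even if \<open>X\<close>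
      takes \<open>m - 1 - k\<close> elements there.\<close>
    define N where "N = (c - k) + (M - 2 * c - 1)"
    define q where "q = s - 1 - N"
    define S where "S i = (if i < c - k then {n - 2 * i - 1, n - 2 * i}
      else {n - 2 * c - 1 - (i - (c - k))})" for i
    have cardX: "card X \<le> m + c + 1"
    proof -
      have "card X \<le> (m - 1 - k) + (2 * k + 1)"
        unfolding X_def by (rule order_trans[OF card_Un_le]) (use big M in simp)
      then show ?thesis using k by linarith
    qed
    have "has_packing F X (N + q)"
    proof (rule extend)
      show "S i \<in> G" if "i < N" for i
      proof (cases "i < c - k")
        case True
        then have "{n - 2 * i - 1, n - 2 * i} \<subseteq> ?T" "card {n - 2 * i - 1, n - 2 * i} = 2"
          using M Mn by auto
        then show ?thesis using Q(2) True by (simp add: S_def)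
      next
        case False
        have "{n - 2 * c - 1 - (i - (c - k))} \<in> G"
          by (rule Q(1)) (use that False M Mn N_def in auto)
        then show ?thesis using False by (simp add: S_def)
      qed
      show "S i \<inter> X = {}" if "i < N" for i
        using that M big by (auto simp: S_def X_def N_def)
      have "S i \<inter> S j = {}" if "i < j" "j < N" for i j
        using that M big by (auto simp: S_def N_def)
      then show "disjoint_family_on S {..<N}"
        unfolding disjoint_family_on_def by (metis Int_commute lessThan_iff linorder_neqE_nat)
      have "X \<inter> {1..n - M} \<subseteq> {0<..m - 1 - k}" using M by (auto simp: X_def)
      then have "card (X \<inter> {1..n - M}) \<le> m - 1 - k" using card_mono[of "{0<..m - 1 - k}"] by fastforce
      moreover have "s = N + 1 + q" using s M by (simp add: N_def q_def)
      then have "m * s = m * N + m + m * q" by (simp add: distrib_left)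
      moreover have "N + c + k + 1 = M" using M k by (simp add: N_def)
      ultimately show "card (X \<inter> {1..n - M}) + (m - 1) * N + m * q \<le> n - M"
        using pred_mult[of N] k n by linarith
    qed (use cardX s M N_def q_def in \<open>auto simp: X_def\<close>)
    moreover have "N + q = s - 1" using s M by (simp add: N_def q_def)
    ultimately show ?thesis by (simp add: X_def)
  next
    case W
    define X where "X = {0<..m - 1} \<union> {n - 2<..n}"
    \<comment> \<open>\<open>X\<close> takes the top two elements and the other \<open>M - 2\<close>
      serve as singletons; with \<open>c = 1\<close> the fit is again exact.\<close>
    define N where "N = M - 2"
    define q where "q = s - 1 - N"
    have cardX: "card X \<le> m + c + 1"
    proof -
      have "card X \<le> (m - 1) + 2"
        unfolding X_def by (rule order_trans[OF card_Un_le]) (use big in simp)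
      then show ?thesis using m c by linarith
    qed
    have "has_packing F X (N + q)"
    proof (rule extend)
      show "{n - 2 - i} \<in> G" if "i < N" for i
        by (rule W(2)) (use that M Mn N_def in auto)
      show "{n - 2 - i} \<inter> X = {}" if "i < N" for i
        using that M big by (auto simp: X_def N_def)
      show "disjoint_family_on (\<lambda>i. {n - 2 - i}) {..<N}"
        using M big by (auto simp: disjoint_family_on_def N_def)
      have "X \<inter> {1..n - M} \<subseteq> {0<..m - 1}" using M W by (auto simp: X_def)
      then have "card (X \<inter> {1..n - M}) \<le> m - 1" using card_mono[of "{0<..m - 1}"] by fastforce
      moreover have "s = N + 1 + q" using s M by (simp add: N_def q_def)
      then have "m * s = m * N + m + m * q" by (simp add: distrib_left)
      moreover have "N + 2 = M" using M by (simp add: N_def)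
      ultimately show "card (X \<inter> {1..n - M}) + (m - 1) * N + m * q \<le> n - M"
        using pred_mult[of N] m W(1) n by linarith
    qed (use cardX s M N_def q_def in \<open>auto simp: X_def\<close>)
    moreover have "N + q = s - 1" using s M by (simp add: N_def q_def)
    ultimately show ?thesis using W(1) by (simp add: X_def)
  qed
qed

section \<open>Counting missing sets through traces\<close>

text \<open>An \<open>(m - 1)\<close>-set either meets the block, or has one of boundedly many
  traces with few missing sets, or is \<open>good\<close>. The first two kinds number
  O(\<open>n ^ (m - 2)\<close>), the second because a frequent trace would give a forbidden packing;
  each good set contributes \<open>2 * c + 3\<close> missing sets of its own.\<close>

lemma choose_le_missing:
  assumes F: "compression_closed {1..n} F" and n: "n = m * s + c"
    and m: "m \<ge> 2" and c: "c \<ge> 1" and M: "2 * c + 2 \<le> M" and s: "2 * M + 2 \<le> s"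
    and missing: "2 ^ (m - 1) * card (Pow {1..n} - F) < M * s ^ (m - 1)"
    and k: "k \<le> c" "k < m"
    and no_packing: "\<not> has_packing F {} s"
      "\<not> has_packing F ({0<..m - 1 - k} \<union> {n - 2 * c - 1<..n - 2 * c + 2 * k}) (s - 1)"
      "c = 1 \<Longrightarrow> \<not> has_packing F ({0<..m - 1} \<union> {n - 2<..n}) (s - 1)"
  shows "(2 * c + 3) * (n choose (m - 1)) \<le> card (Pow {1..n} - F)
    + (2 * c + 3) * (M + 2 ^ 2 ^ M * (m + c + 1 + M * m)) * n ^ (m - 2)"
proof -
  let ?T = "{n - M<..n}" and ?V = "{1..n - M}"
  let ?K = "m + c + 1 + M * m"
  have "2 * s \<le> m * s" using m by (intro mult_le_mono1)
  then have Mn: "M \<le> n" using s n by linarith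
  have V: "?V \<subseteq> {1..n}" and T: "?T \<subseteq> {1..n}" and VT: "?V \<inter> ?T = {}" and VT': "{1..n} - ?T \<subseteq> ?V"
    by auto
  define trace where "trace D = {S. S \<subseteq> ?T \<and> D \<union> S \<in> F}" for D
  define with_trace where "with_trace G = {D. D \<subseteq> ?V \<and> card D = m - 1 \<and> trace D = G}" for G
  define \<G> where "\<G> = {G. G \<subseteq> Pow ?T \<and> card (Pow ?T - G) \<le> 2 * c + 2}"
  define good where "good = {D. D \<subseteq> ?V \<and> card D = m - 1 \<and> 2 * c + 3 \<le> card (Pow ?T - trace D)}"
  have rare: "card (with_trace G) \<le> ?K * n ^ (m - 2)" if "G \<in> \<G>" for G
  proof (rule ccontr)
    assume "\<not> ?thesis"
    then show False
      using frequent_trace_has_packing[OF F n m c M s missing, of G k] that k no_packing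
      unfolding \<G>_def with_trace_def trace_def by auto
  qed
  have fin\<G>: "finite \<G>" by (rule finite_subset[of _ "Pow (Pow ?T)"]) (auto simp: \<G>_def)
  have "card \<G> \<le> card (Pow (Pow ?T))" by (rule card_mono) (auto simp: \<G>_def)
  then have card\<G>: "card \<G> \<le> 2 ^ 2 ^ M" using Mn by (simp add: card_Pow)
  let ?meet = "{D. D \<subseteq> {1..n} \<and> card D = m - 1 \<and> D \<inter> ?T \<noteq> {}}"
  have "D \<in> ?meet \<union> (\<Union>G\<in>\<G>. with_trace G) \<union> good" if D: "D \<subseteq> {1..n}" "card D = m - 1" for D
  proof (cases "D \<inter> ?T = {}")
    case True
    then have DV: "D \<subseteq> ?V" using D VT' by blast
    show ?thesis
    proof (cases "2 * c + 3 \<le> card (Pow ?T - trace D)")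
      case True
      then show ?thesis using DV D by (simp add: good_def)
    next
      case False
      moreover have "trace D \<subseteq> Pow ?T" by (auto simp: trace_def)
      ultimately have "trace D \<in> \<G>" by (simp add: \<G>_def)
      moreover have "D \<in> with_trace (trace D)" using DV D by (simp add: with_trace_def)
      ultimately show ?thesis by blast
    qed
  qed (use D in blast)
  then have "{D. D \<subseteq> {1..n} \<and> card D = m - 1} \<subseteq> ?meet \<union> (\<Union>G\<in>\<G>. with_trace G) \<union> good" by blast
  moreover have "finite good" by (rule finite_subset[of _ "Pow ?V"]) (auto simp: good_def)
  moreover have "finite (\<Union>G\<in>\<G>. with_trace G)"
    by (rule finite_subset[of _ "Pow ?V"]) (auto simp: with_trace_def)
  ultimately have "card {D. D \<subseteq> {1..n} \<and> card D = m - 1}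
      \<le> card (?meet \<union> (\<Union>G\<in>\<G>. with_trace G) \<union> good)" by (intro card_mono) auto
  also have "\<dots> \<le> card ?meet + card (\<Union>G\<in>\<G>. with_trace G) + card good"
    using card_Un_le[of "?meet \<union> (\<Union>G\<in>\<G>. with_trace G)" good]
      card_Un_le[of ?meet "\<Union>G\<in>\<G>. with_trace G"] by linarith
  also have "card {D. D \<subseteq> {1..n} \<and> card D = m - 1} = n choose (m - 1)" by (simp add: n_subsets)
  finally have "n choose (m - 1) \<le> card ?meet + card (\<Union>G\<in>\<G>. with_trace G) + card good" .
  moreover have "card ?meet \<le> M * n ^ (m - 2)"
    using card_subsets_meeting[of ?T "m - 1" n] m Mn by (simp add: numeral_2_eq_2)
  moreover have "card (\<Union>G\<in>\<G>. with_trace G) \<le> 2 ^ 2 ^ M * (?K * n ^ (m - 2))"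
  proof -
    have "card (\<Union>G\<in>\<G>. with_trace G) \<le> (\<Sum>G\<in>\<G>. card (with_trace G))" by (rule card_UN_le[OF fin\<G>])
    also have "\<dots> \<le> card \<G> * (?K * n ^ (m - 2))" using sum_bounded_above[OF rare] by simp
    also have "\<dots> \<le> 2 ^ 2 ^ M * (?K * n ^ (m - 2))" using card\<G> by (rule mult_le_mono1)
    finally show ?thesis .
  qed
  ultimately have "n choose (m - 1) \<le> M * n ^ (m - 2) + 2 ^ 2 ^ M * (?K * n ^ (m - 2)) + card good"
    by linarith
  also have "\<dots> = (M + 2 ^ 2 ^ M * ?K) * n ^ (m - 2) + card good" by (simp add: algebra_simps)
  finally have "(2 * c + 3) * (n choose (m - 1))
      \<le> (2 * c + 3) * ((M + 2 ^ 2 ^ M * ?K) * n ^ (m - 2) + card good)" by (rule mult_le_mono2)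
  also have "\<dots> = (2 * c + 3) * (M + 2 ^ 2 ^ M * ?K) * n ^ (m - 2) + (2 * c + 3) * card good"
    by (simp add: distrib_left mult.assoc)
  also have "(2 * c + 3) * card good \<le> card (Pow {1..n} - F)"
  proof -
    let ?A = "SIGMA D:good. Pow ?T - trace D"
    \<comment> \<open>A union determines both its parts, so different pairs \<open>(D, S)\<close>
      count different missing sets.\<close>
    have dec: "D = (D \<union> S) \<inter> ?V \<and> S = (D \<union> S) \<inter> ?T" if "D \<subseteq> ?V" "S \<subseteq> ?T" for D S
      using that VT by blast
    have "inj_on (\<lambda>(D, S). D \<union> S) ?A"
    proof (rule inj_onI, clarify)
      fix D S D' S'
      assume "D \<in> good" "D' \<in> good" "S \<subseteq> ?T" "S' \<subseteq> ?T" "D \<union> S = D' \<union> S'"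
      then show "D = D' \<and> S = S'" using dec[of D S] dec[of D' S'] by (simp add: good_def)
    qed
    moreover have "(\<lambda>(D, S). D \<union> S) ` ?A \<subseteq> Pow {1..n} - F"
    proof clarify
      fix D S assume "D \<in> good" "S \<subseteq> ?T" "S \<notin> trace D"
      then have "D \<union> S \<notin> F" "D \<union> S \<subseteq> ?V \<union> ?T" by (auto simp only: good_def trace_def)
      then show "D \<union> S \<in> Pow {1..n} - F" using V T by blast
    qed
    ultimately have "card ?A \<le> card (Pow {1..n} - F)" by (rule card_inj_on_le) simp
    moreover have "card ?A = (\<Sum>D\<in>good. card (Pow ?T - trace D))"
      using \<open>finite good\<close> by (intro card_SigmaI) auto
    moreover have "(\<Sum>D\<in>good. 2 * c + 3) \<le> (\<Sum>D\<in>good. card (Pow ?T - trace D))"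
      by (rule sum_mono) (simp add: good_def)
    ultimately show ?thesis by (simp add: mult.commute)
  qed
  finally show ?thesis by simp
qed

section \<open>From shifted families to compression-closed families\<close>

text \<open>
  The empty set is excluded because disjoint members of the closure have to shrink to distinct
  members of \<open>F\<close>.
\<close>

definition compression_closure :: "nat set \<Rightarrow> nat set set \<Rightarrow> nat set set" where
  "compression_closure V F = {B. B \<subseteq> V \<and> (\<exists>A\<in>F. A \<noteq> {} \<and> compresses A B)}"

lemma compression_closed_closure: "compression_closed V (compression_closure V F)"
  unfolding compression_closed_def compression_closure_def using compresses_trans by blast

lemma has_packing_closure:
  assumes F: "F \<subseteq> Pow {1..n}" "shifted n F" and "has_packing (compression_closure {1..n} F) X q"
  shows "has_packing (F - {{}}) X q"
proof -
  obtain M where M: "M \<subseteq> compression_closure {1..n} F" "disjoint M" "card M = q"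
      "\<And>A. A \<in> M \<Longrightarrow> A \<inter> X = {}"
    using assms(3) unfolding has_packing_def by blast
  have "\<exists>A\<in>F. A \<noteq> {} \<and> A \<subseteq> B" if "B \<in> M" for B
  proof -
    have "B \<in> compression_closure {1..n} F" using M(1) that by blast
    then obtain A where A: "A \<in> F" "A \<noteq> {}" "B \<subseteq> {1..n}" "compresses A B"
      unfolding compression_closure_def by blast
    then obtain f where f: "inj_on f A" "f ` A \<subseteq> B" "\<And>a. a \<in> A \<Longrightarrow> f a \<le> a"
      unfolding compresses_def by auto
    have "finite A" using A(1) F(1) finite_subset[of A "{1..n}"] by auto
    then have "shifts_to A (f ` A)" using f by (intro shifts_to_image)
    moreover have "f ` A \<subseteq> {1..n}" using A(3) f(2) by blast
    ultimately have "f ` A \<in> F" using F(2) A(1) unfolding shifted_def by blast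
    then show ?thesis using f(2) A(2) by (intro bexI[of _ "f ` A"]) auto
  qed
  then obtain h where h: "\<And>B. B \<in> M \<Longrightarrow> h B \<in> F" "\<And>B. B \<in> M \<Longrightarrow> h B \<noteq> {}" "\<And>B. B \<in> M \<Longrightarrow> h B \<subseteq> B"
    by metis
  have disj: "h B \<inter> h B' = {}" if "B \<in> M" "B' \<in> M" "B \<noteq> B'" for B B'
    using M(2) h(3)[OF that(1)] h(3)[OF that(2)] that unfolding pairwise_def disjnt_def by blast
  have "inj_on h M"
  proof (rule inj_onI)
    fix B B' assume "B \<in> M" "B' \<in> M" "h B = h B'"
    then show "B = B'" using disj[of B B'] h(2)[of B'] by (cases "B = B'") auto
  qed
  then have "card (h ` M) = q" using M(3) by (simp add: card_image)
  moreover have "h ` M \<subseteq> F - {{}}" using h by blast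
  moreover have "disjoint (h ` M)"
  proof (rule pairwiseI)
    fix C C' assume "C \<in> h ` M" "C' \<in> h ` M" "C \<noteq> C'"
    then show "disjnt C C'" using disj by (force simp: disjnt_def)
  qed
  moreover have "C \<inter> X = {}" if "C \<in> h ` M" for C
    using that h(3) M(4) by blast
  ultimately show ?thesis unfolding has_packing_def by blast
qed

lemma has_packing_mono: "has_packing F X q \<Longrightarrow> F \<subseteq> F' \<Longrightarrow> has_packing F' X q"
  unfolding has_packing_def by (elim exE conjE, intro exI conjI) auto

lemma has_packing_insert:
  assumes "finite F" "has_packing F X q" "X \<in> F'" "F \<subseteq> F'" "X \<notin> F \<or> X \<noteq> {}"
  shows "has_packing F' {} (Suc q)"
proof -
  obtain M where M: "M \<subseteq> F" "disjoint M" "card M = q" "\<And>A. A \<in> M \<Longrightarrow> A \<inter> X = {}"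
    using assms(2) unfolding has_packing_def by blast
  \<comment> \<open>A member of \<open>M\<close> equal to \<open>X\<close> would be disjoint from
    itself, hence empty; the last assumption excludes this.\<close>
  have "X \<notin> M" using M(1) M(4)[of X] assms(5) by auto
  moreover have "finite M" using M(1) assms(1) by (rule finite_subset)
  ultimately have "card (insert X M) = Suc q" using M(3) by simp
  moreover have "disjoint (insert X M)"
    using M(2,4) by (auto simp: pairwise_insert disjnt_def)
  moreover have "insert X M \<subseteq> F'" using M(1) assms(3,4) by blast
  ultimately show ?thesis unfolding has_packing_def by blast
qed

lemma not_has_packing:
  assumes "finite F" "matching_number F < s"
  shows "\<not> has_packing F {} s"
proof
  assume "has_packing F {} s"
  then obtain M where M: "M \<subseteq> F" "disjoint M" "card M = s" unfolding has_packing_def by blast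
  have "finite {card M | M. M \<subseteq> F \<and> disjoint M}"
    by (rule finite_subset[of _ "card ` Pow F"]) (use assms(1) in auto)
  then have "s \<le> matching_number F"
    unfolding matching_number_def using M by (intro Max_ge) auto
  with assms(2) show False by simp
qed

section \<open>Leftmost sets outside the two extremal families\<close>

text \<open>With \<open>a\<close> elements up to \<open>m * s - c - 1 = n - 2 * c - 1\<close> and
  \<open>b\<close> above, being outside \<open>\<Q>\<close> means \<open>2 * a + b < 2 * m\<close>.
  For \<open>k = b div 2\<close> this gives \<open>a \<le> m - 1 - k\<close> and
  \<open>b \<le> 2 * k + 1\<close>, and each part is pushed to the left end of its range.\<close>

lemma compresses_outside_Q:
  assumes n: "n = m * s + c" and l: "s = l + c" and s: "m + 2 * c + 1 \<le> n"
    and P: "P \<subseteq> {1..n}" "P \<notin> family_Q m s l"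
  obtains k where "k \<le> c" "k < m"
    "compresses P ({0<..m - 1 - k} \<union> {n - 2 * c - 1<..n - 2 * c + 2 * k})"
proof -
  let ?t = "n - 2 * c - 1"
  have finP: "finite P" using P(1) finite_subset by blast
  define a where "a = card (P \<inter> {..?t})"
  define b where "b = card (P \<inter> {?t<..})"
  have split: "P = (P \<inter> {..?t}) \<union> (P \<inter> {?t<..})" by auto
  have "card P = a + b"
    unfolding a_def b_def by (subst (1) split, subst card_Un_disjoint) (use finP in auto)
  moreover have "P \<inter> {1..m * s - c - 1} = P \<inter> {..?t}" using P(1) n by auto
  ultimately have ab: "2 * a + b < 2 * m"
    using P l n unfolding family_Q_def a_def by (simp add: Let_def)
  have "b \<le> card {?t<..n}" unfolding b_def using P(1) by (intro card_mono) auto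
  then have b: "b \<le> 2 * c + 1" using n s by simp
  define k where "k = b div 2"
  have k: "k \<le> c" "k < m" "a \<le> m - 1 - k" "b \<le> 2 * k + 1"
    using b ab unfolding k_def by linarith+
  show thesis
  proof (rule that[OF k(1,2)])
    have "compresses (P \<inter> {..?t}) {0<..0 + (m - 1 - k)}"
      using finP P(1) k(3) unfolding a_def by (intro compresses_interval) auto
    moreover have eq: "?t + (2 * k + 1) = n - 2 * c + 2 * k" using s by simp
    have "compresses (P \<inter> {?t<..}) {?t<..n - 2 * c + 2 * k}"
      unfolding eq[symmetric] using finP k(4) unfolding b_def by (intro compresses_interval) auto
    moreover have "{0<..m - 1 - k} \<inter> {?t<..n - 2 * c + 2 * k} = {}" using s by auto
    ultimately have "compresses ((P \<inter> {..?t}) \<union> (P \<inter> {?t<..}))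
        ({0<..m - 1 - k} \<union> {?t<..n - 2 * c + 2 * k})" by (intro compresses_Un) simp_all
    then show "compresses P ({0<..m - 1 - k} \<union> {?t<..n - 2 * c + 2 * k})"
      using split by simp
  qed
qed

text \<open>Fewer than \<open>m\<close> elements lie in \<open>{1..n - 2}\<close> and can be pushed
  to the left end; at most \<open>n - 1\<close> and \<open>n\<close> remain.\<close>

lemma compresses_outside_W:
  assumes n: "n = m * s + 1" and l: "s = l + 1" and s: "m + 1 \<le> n"
    and P: "P \<subseteq> {1..n}" "P \<notin> family_W m s l"
  shows "compresses P ({0<..m - 1} \<union> {n - 2<..n})"
proof -
  have finP: "finite P" using P(1) finite_subset by blast
  have "P \<inter> {1..m * s - 1} = P \<inter> {..n - 2}" using P(1) n by auto
  then have "card (P \<inter> {..n - 2}) < m"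
    using P l n unfolding family_W_def by (simp add: Let_def)
  then have "compresses (P \<inter> {..n - 2}) {0<..0 + (m - 1)}"
    using finP P(1) by (intro compresses_interval) auto
  moreover have "compresses (P \<inter> {n - 2<..}) {n - 2<..n}"
    using P(1) by (intro compresses_mono) auto
  moreover have "{0<..m - 1} \<inter> {n - 2<..n} = {}" using s by auto
  ultimately have "compresses ((P \<inter> {..n - 2}) \<union> (P \<inter> {n - 2<..})) ({0<..m - 1} \<union> {n - 2<..n})"
    by (intro compresses_Un) simp_all
  moreover have "(P \<inter> {..n - 2}) \<union> (P \<inter> {n - 2<..}) = P" by auto
  ultimately show ?thesis by simp
qed

text \<open>\<open>X\<close> joins the closure as a compressed copy of \<open>P\<close>, so
  \<open>s - 1\<close> disjoint members avoiding it would complete a matching of size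
  \<open>s\<close>.\<close>

lemma no_packing_of_compression:
  assumes F: "F \<subseteq> Pow {1..n}" "shifted n F" and \<nu>: "matching_number F < s"
    and P: "P \<in> F" "compresses P X" and X: "X \<subseteq> {1..n}" "X \<noteq> {}"
  shows "\<not> has_packing (compression_closure {1..n} F) X (s - 1)"
proof
  let ?F = "compression_closure {1..n} F"
  assume pack: "has_packing ?F X (s - 1)"
  have s: "Suc (s - 1) = s" using \<nu> by simp
  have finF: "finite F" using F(1) by (rule finite_subset) simp
  have "has_packing F {} s"
  \<comment> \<open>The empty set generates nothing in the closure; instead it is added itself to
    the \<open>s - 1\<close> nonempty members of \<open>F\<close>.\<close>
  proof (cases "P = {}")
    case True
    obtain M where "M \<subseteq> F - {{}}" "disjoint M" "card M = s - 1"
      using has_packing_closure[OF F pack] unfolding has_packing_def by blast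
    then have "has_packing (F - {{}}) {} (s - 1)" unfolding has_packing_def by blast
    then have "has_packing F {} (Suc (s - 1))"
      by (rule has_packing_insert[rotated]) (use finF P True in auto)
    then show ?thesis unfolding s .
  next
    case False
    have "X \<in> ?F" using P X False unfolding compression_closure_def by blast
    moreover have "finite ?F"
      by (rule finite_subset[of _ "Pow {1..n}"]) (auto simp: compression_closure_def)
    ultimately have "has_packing ?F {} (Suc (s - 1))"
      using has_packing_insert[OF _ pack] X(2) by blast
    then have "has_packing (F - {{}}) {} s" using has_packing_closure[OF F] unfolding s by blast
    then show ?thesis unfolding has_packing_def by blast
  qed
  then show False using not_has_packing[OF finF \<nu>] by blast
qed

section \<open>Choice of constants and conclusion\<close>

theorem theorem4:
  fixes m c :: nat
  assumes "m \<ge> 2" and "c \<ge> 1"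
  shows "\<exists>(C::real) (s0::nat). C > 0 \<and> s0 > 0 \<and>
    (\<forall>s n l :: nat. \<forall>F :: nat set set.
       s \<ge> s0 \<longrightarrow> n = m * s + c \<longrightarrow> s = l + c \<longrightarrow>
       F \<subseteq> Pow {1..n} \<longrightarrow> shifted n F \<longrightarrow> matching_number F < s \<longrightarrow>
       (c \<ge> 2 \<and> \<not> F \<subseteq> family_Q m s l) \<or>
       (c = 1 \<and> \<not> F \<subseteq> family_Q m s l \<and> \<not> F \<subseteq> family_W m s l) \<longrightarrow>
       real (card (Pow {1..n} - F)) \<ge>
         (2 * real c + 3) * real (n choose (m - 1)) - C * real s ^ (m - 2))"
proof -
  note m = assms(1) and c = assms(2)
  \<comment> \<open>Chosen so that \<open>M * s ^ (m - 1)\<close> equals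
    \<open>2 ^ (m - 1) * (2 * c + 3) * ((m + 1) * s) ^ (m - 1)\<close>, where
    \<open>(m + 1) * s\<close> bounds \<open>n\<close>.\<close>
  define M where "M = (2 * c + 3) * (2 * (m + 1)) ^ (m - 1)"
  define K where "K = (2 * c + 3) * (M + 2 ^ 2 ^ M * (m + c + 1 + M * m))"
  \<comment> \<open>The factor \<open>(m + 1) ^ (m - 2)\<close> converts powers of \<open>n\<close>
    into powers of \<open>s\<close>; the final \<open>1\<close> pays for the empty set.\<close>
  define C where "C = K * (m + 1) ^ (m - 2) + 1"
  have "2 * c + 3 \<le> M" unfolding M_def by simp
  then have M: "2 * c + 2 \<le> M" by simp
  have main: "(2 * c + 3) * (n choose (m - 1)) \<le> card (Pow {1..n} - F) + C * s ^ (m - 2)"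
    if s: "2 * M + m + 2 \<le> s" and n: "n = m * s + c" and l: "s = l + c"
      and F: "F \<subseteq> Pow {1..n}" "shifted n F" and \<nu>: "matching_number F < s"
      and notQ: "\<not> F \<subseteq> family_Q m s l" and notW: "c = 1 \<Longrightarrow> \<not> F \<subseteq> family_W m s l"
    for s n l :: nat and F
  proof -
    let ?F = "compression_closure {1..n} F"
    have n_le: "n \<le> (m + 1) * s" using n l by simp
    have "2 * s \<le> m * s" using m by (intro mult_le_mono1)
    then have big: "m + 2 * c + 2 \<le> n" using n s M by linarith
    have finF: "finite F" using F(1) by (rule finite_subset) simp
    obtain P where P: "P \<in> F" "P \<notin> family_Q m s l" using notQ by blast
    have "P \<subseteq> {1..n}" "m + 2 * c + 1 \<le> n" using P F(1) big by auto
    from compresses_outside_Q[OF n l this(2,1) P(2)] obtain k where k: "k \<le> c" "k < m"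
      and Pk: "compresses P ({0<..m - 1 - k} \<union> {n - 2 * c - 1<..n - 2 * c + 2 * k})" by blast
    have no1: "\<not> has_packing ?F {} s"
    proof
      assume "has_packing ?F {} s"
      then have "has_packing F {} s"
        using has_packing_closure[OF F] has_packing_mono Diff_subset by metis
      then show False using not_has_packing[OF finF \<nu>] by blast
    qed
    have no2: "\<not> has_packing ?F ({0<..m - 1 - k} \<union> {n - 2 * c - 1<..n - 2 * c + 2 * k}) (s - 1)"
      by (rule no_packing_of_compression[OF F \<nu> P(1) Pk]) (use big k in auto)
    have no3: "\<not> has_packing ?F ({0<..m - 1} \<union> {n - 2<..n}) (s - 1)" if c1: "c = 1"
    proof -
      obtain P' where P': "P' \<in> F" "P' \<notin> family_W m s l" using notW[OF c1] by blast
      have "compresses P' ({0<..m - 1} \<union> {n - 2<..n})"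
        using n l c1 big P' F(1) by (intro compresses_outside_W[of n m s l]) auto
      then show ?thesis by (rule no_packing_of_compression[OF F \<nu> P'(1)]) (use big in auto)
    qed
    have "(2 * c + 3) * (n choose (m - 1)) \<le> card (Pow {1..n} - ?F) + K * n ^ (m - 2)"
    \<comment> \<open>If too many sets are missing for the packing argument, the choice of
      \<open>M\<close> gives the bound outright.\<close>
    proof (cases "2 ^ (m - 1) * card (Pow {1..n} - ?F) < M * s ^ (m - 1)")
      case True
      show ?thesis unfolding K_def
        by (rule choose_le_missing[OF compression_closed_closure n m c M _ True k no1 no2 no3])
          (use s in simp)
    next
      case False
      have "n choose (m - 1) \<le> n ^ (m - 1)"
        by (cases "m - 1 \<le> n") (simp_all add: binomial_le_pow binomial_eq_0)
      also have "\<dots> \<le> ((m + 1) * s) ^ (m - 1)" using n_le by (rule power_mono) simp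
      finally have "2 ^ (m - 1) * ((2 * c + 3) * (n choose (m - 1)))
          \<le> 2 ^ (m - 1) * ((2 * c + 3) * ((m + 1) * s) ^ (m - 1))" by (intro mult_le_mono2)
      also have "\<dots> = M * s ^ (m - 1)" unfolding M_def power_mult_distrib by (simp only: ac_simps)
      also have "\<dots> \<le> 2 ^ (m - 1) * card (Pow {1..n} - ?F)" using False by simp
      finally show ?thesis by simp
    qed
    also have "K * n ^ (m - 2) \<le> K * ((m + 1) * s) ^ (m - 2)"
      using n_le by (intro mult_le_mono2 power_mono) auto
    also have "\<dots> = K * (m + 1) ^ (m - 2) * s ^ (m - 2)" by (simp only: power_mult_distrib mult.assoc)
    \<comment> \<open>The closure contains every nonempty member of \<open>F\<close> but never the
      empty set, so at most one further set is missing.\<close>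
    also have "card (Pow {1..n} - ?F) \<le> card (insert {} (Pow {1..n} - F))"
      using F(1) compresses_mono[OF order_refl]
      by (intro card_mono) (auto simp: compression_closure_def)
    also have "\<dots> \<le> card (Pow {1..n} - F) + s ^ (m - 2)"
    proof -
      have "1 \<le> s ^ (m - 2)" using s by simp
      then show ?thesis using card_insert_le_m1[of _ "Pow {1..n} - F" "{}"] card_insert_if[of "Pow {1..n} - F" "{}"]
        by (auto split: if_splits)
    qed
    finally show ?thesis by (simp add: C_def algebra_simps)
  qed
  show ?thesis
  proof (intro exI[of _ "real C"] exI[of _ "2 * M + m + 2"] conjI allI impI)
    fix s n l :: nat and F :: "nat set set"
    assume *: "2 * M + m + 2 \<le> s" "n = m * s + c" "s = l + c" "F \<subseteq> Pow {1..n}" "shifted n F"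
      "matching_number F < s"
      "(c \<ge> 2 \<and> \<not> F \<subseteq> family_Q m s l) \<or>
       (c = 1 \<and> \<not> F \<subseteq> family_Q m s l \<and> \<not> F \<subseteq> family_W m s l)"
    then have "(2 * c + 3) * (n choose (m - 1)) \<le> card (Pow {1..n} - F) + C * s ^ (m - 2)"
      by (intro main) auto
    then have "real ((2 * c + 3) * (n choose (m - 1)))
        \<le> real (card (Pow {1..n} - F) + C * s ^ (m - 2))" by (rule of_nat_mono)
    then show "real (card (Pow {1..n} - F))
        \<ge> (2 * real c + 3) * real (n choose (m - 1)) - real C * real s ^ (m - 2)" by simp
  next
    show "real C > 0" by (simp only: of_nat_0_less_iff) (simp add: C_def)
  qed simp
qed

end
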